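(* Let $k,n\ge 2$ and $d\ge 1$ be integers, and let $m=x_1^{a_1}\cdots x_n^{a_n}$ be a monomial of degree $dk$ in $S=\mathbb{C}[x_1,\dots,x_n]$. Suppose that $(k-2)n\le d$. Then $\mathrm{rk}_k(m)\le k$.
   Context: For a form $f\in S$ of degree $kd$, the $k$-rank $\mathrm{rk}_k(f)$ is the smallest $s$ such that $f=g_1^k+\dots+g_s^k$ for some homogeneous polynomials $g_1,\dots,g_s\in S$ of degree $d$. *)

theory Defs
  imports Complex_Main "HOL-Library.Poly_Mapping" "HOL-Library.Extended_Nat"
begin

text \<open>Polynomials in the indeterminates \<open>x\<^sub>i\<close> (\<open>i :: nat\<close>) are finitely supported
  maps from exponent vectors to coefficients; multiplication of poly mappings is convolution.\<close>

type_synonym cpoly = "(nat \<Rightarrow>\<^sub>0 nat) \<Rightarrow>\<^sub>0 complex"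

text \<open>The subring \<open>\<complex>[x\<^sub>1, \<dots>, x\<^sub>n]\<close>.\<close>

definition poly_ring :: "nat \<Rightarrow> cpoly set" where
  "poly_ring n = {p. \<forall>t \<in> Poly_Mapping.keys p. Poly_Mapping.keys t \<subseteq> {1..n}}"

definition indet :: "nat \<Rightarrow> cpoly" where
  "indet i = Poly_Mapping.single (Poly_Mapping.single i 1) 1"

definition expo_degree :: "(nat \<Rightarrow>\<^sub>0 nat) \<Rightarrow> nat" where
  "expo_degree t = (\<Sum>i \<in> Poly_Mapping.keys t. Poly_Mapping.lookup t i)"

text \<open>The zero polynomial is homogeneous of every degree.\<close>

definition homogeneous :: "nat \<Rightarrow> cpoly \<Rightarrow> bool" where
  "homogeneous d p \<longleftrightarrow> (\<forall>t \<in> Poly_Mapping.keys p. expo_degree t = d)"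

text \<open>\<open>k_rank n d k f\<close> is the \<open>k\<close>-rank of a form \<open>f\<close> of degree \<open>k * d\<close> in
  \<open>\<complex>[x\<^sub>1, \<dots>, x\<^sub>n]\<close>.  It is \<open>enat\<close>-valued so that the infimum over an empty
  set of lengths is \<open>\<infinity>\<close>; in particular a finite upper bound asserts that a
  decomposition exists.\<close>

definition k_rank :: "nat \<Rightarrow> nat \<Rightarrow> nat \<Rightarrow> cpoly \<Rightarrow> enat" where
  "k_rank n d k f = Inf {enat s | s. \<exists>g :: nat \<Rightarrow> cpoly.
     (\<forall>j \<in> {1..s}. g j \<in> poly_ring n \<and> homogeneous d (g j)) \<and> f = (\<Sum>j = 1..s. g j ^ k)}"

end

theory Submission
  imports Defs
begin

text \<open>
  The proof splits \<open>m\<close> as \<open>u ^ (k - 1) * v\<close> with two monomials \<open>u\<close>, \<open>v\<close> of degree \<open>d\<close>, and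
  observes that every product of this shape is a sum of \<open>k\<close> many \<open>k\<close>-th powers of linear
  combinations of \<open>u\<close> and \<open>v\<close>.

  The second step is a discrete Fourier transform. Let \<open>w\<close> be a primitive \<open>k\<close>-th root of unity and
  expand \<open>\<Sum>j. w ^ (-j) * (u + w ^ j * v) ^ k\<close> by the binomial theorem: the term
  \<open>u ^ (k - i) * v ^ i\<close> gets the coefficient \<open>(k choose i) * (\<Sum>j. w ^ (j * (i - 1)))\<close>, which
  vanishes unless \<open>i \<equiv> 1\<close> modulo \<open>k\<close>, so only \<open>k\<^sup>2 * u ^ (k - 1) * v\<close> survives. Over the
  complex numbers the scalars \<open>w ^ (-j) / k\<^sup>2\<close> are \<open>k\<close>-th powers and can be absorbed
  (\<open>power_mult_eq_sum_of_powers\<close>).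

  For the first step, the exponents of \<open>v\<close> have to be congruent to the \<open>a i\<close> modulo \<open>k - 1\<close>, and
  at most \<open>a i\<close>. The smallest choice, \<open>a i mod (k - 1)\<close>, has total degree at most
  \<open>(k - 2) * n\<close>, hence at most \<open>d\<close> by hypothesis. The total degree of \<open>m\<close> is \<open>d * k\<close>, which is
  congruent to \<open>d\<close> modulo \<open>k - 1\<close> and at least \<open>d\<close>, so that adding multiples of \<open>k - 1\<close> to some
  exponents of \<open>v\<close> reaches \<open>d\<close> exactly, and this leaves degree \<open>d\<close> for \<open>u\<close>
  (\<open>split_exponents\<close>).
\<close>

section \<open>Splitting the exponent vector\<close>

lemma exists_bounded_sum_eq:
  fixes q :: "'a \<Rightarrow> nat"
  assumes "finite A" and "T \<le> sum q A"
  shows "\<exists>t. (\<forall>i\<in>A. t i \<le> q i) \<and> sum t A = T"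
  using assms
proof (induction A arbitrary: T rule: finite_induct)
  case empty
  then show ?case by simp
next
  case (insert x A)
  have "T - min T (q x) \<le> sum q A"
    using insert.prems insert.hyps by simp
  from insert.IH[OF this] obtain t where
    t: "\<forall>i\<in>A. t i \<le> q i" "sum t A = T - min T (q x)" by blast
  have "sum (t(x := min T (q x))) A = sum t A"
    using insert.hyps by (intro sum.cong) auto
  then show ?case
    using t insert.hyps by (intro exI[of _ "t(x := min T (q x))"]) auto
qed

text \<open>
  Here \<open>r\<close> plays the role of \<open>k - 1\<close>. Since \<open>a i mod r \<le> r - 1\<close>, the remainders have sum at most
  \<open>d\<close>. Equivalently, the quotients \<open>a i div r\<close> have sum at least \<open>d\<close>, and so there is room to choose
  \<open>p i \<le> a i div r\<close> with sum exactly \<open>d\<close>; the sum of \<open>q\<close> is then forced to be \<open>d\<close> as well.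
\<close>

lemma split_exponents:
  fixes a :: "'a \<Rightarrow> nat"
  assumes "finite A" and "r > 0" and deg: "sum a A = d * (r + 1)"
    and le: "(r - 1) * card A \<le> d"
  obtains p q where "\<And>i. i \<in> A \<Longrightarrow> a i = r * p i + q i" and "sum p A = d" and "sum q A = d"
proof -
  define R where "R = (\<Sum>i\<in>A. a i mod r)"
  define Q where "Q = (\<Sum>i\<in>A. a i div r)"
  have "R \<le> (\<Sum>i\<in>A. r - 1)"
    unfolding R_def
  proof (rule sum_mono)
    fix i
    show "a i mod r \<le> r - 1" using mod_less_divisor[OF \<open>r > 0\<close>, of "a i"] by linarith
  qed
  then have "R \<le> d" using le by (simp add: mult.commute)
  have RQ: "d * (r + 1) = r * Q + R"
    unfolding deg[symmetric] R_def Q_def sum_distrib_left sum.distrib[symmetric] by simp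
  have "d + r * d = r * Q + R" using RQ by (simp add: algebra_simps)
  then have "int d + int r * int d = int r * int Q + int R"
    by (metis of_nat_add of_nat_mult)
  then have "int d - int R = int r * (int Q - int d)"
    by (simp add: algebra_simps)
  moreover have "int d - int R \<ge> 0" using \<open>R \<le> d\<close> by simp
  ultimately have "int Q \<ge> int d"
    using \<open>r > 0\<close> by (simp add: zero_le_mult_iff)
  then have "d \<le> Q" by simp
  obtain p where p: "\<forall>i\<in>A. p i \<le> a i div r" "sum p A = d"
    using exists_bounded_sum_eq[OF \<open>finite A\<close>, of d "\<lambda>i. a i div r"] \<open>d \<le> Q\<close>
    unfolding Q_def by blast
  define q where "q = (\<lambda>i. a i - r * p i)"
  have split: "a i = r * p i + q i" if "i \<in> A" for i
  proof -
    have "r * p i \<le> r * (a i div r)" using p that by simp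
    also have "\<dots> \<le> a i" by simp
    finally show ?thesis by (simp add: q_def)
  qed
  have "d * (r + 1) = (\<Sum>i\<in>A. r * p i + q i)"
    unfolding deg[symmetric] by (intro sum.cong refl split)
  also have "\<dots> = r * d + sum q A"
    by (simp add: sum.distrib p(2) flip: sum_distrib_left)
  finally have "sum q A = d" by (simp add: algebra_simps)
  with split p(2) show thesis using that by blast
qed

section \<open>A product as a sum of powers\<close>

lemma exists_primitive_root_of_unity:
  assumes "k > 0"
  obtains w :: complex where "w ^ k = 1" and "\<And>i. 0 < i \<Longrightarrow> i < k \<Longrightarrow> w ^ i \<noteq> 1"
proof -
  define w where "w = cis (2 * pi / real k)"
  have w: "w ^ i = cis (2 * pi * real i / real k)" for i
    by (simp add: w_def DeMoivre mult_ac)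
  have bij: "bij_betw (\<lambda>i. w ^ i) {..<k} {z. z ^ k = 1}"
    using bij_betw_roots_unity[OF assms] by (simp add: w)
  show thesis
  proof
    show "w ^ k = 1" using assms by (simp add: w)
    show "w ^ i \<noteq> 1" if "0 < i" "i < k" for i
      using inj_onD[OF bij_betw_imp_inj_on[OF bij], of i 0] that by auto
  qed
qed

lemma exists_complex_root:
  fixes c :: complex
  assumes "k > 0" and "c \<noteq> 0"
  obtains z where "z ^ k = c"
proof -
  have "card {z. z ^ k = c} \<noteq> 0" using card_nth_roots[OF assms(2,1)] assms by simp
  then show thesis using that by fastforce
qed

lemma sum_powers_root_of_unity:
  fixes z :: complex
  assumes "z ^ k = 1"
  shows "(\<Sum>j = 1..k. z ^ j) = (if z = 1 then of_nat k else 0)"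
proof -
  have "(\<Sum>j = 1..k. z ^ j) = z * (\<Sum>j<k. z ^ j)"
    by (simp add: sum_distrib_left sum.shift_bounds_cl_Suc_ivl sum.atLeast1_atMost_eq)
  then show ?thesis
    using assms by (simp add: geometric_sum)
qed

text \<open>
  The weight \<open>w ^ (k - 1) = w ^ (-1)\<close> shifts the index, so that the filter selects the exponent
  \<open>i = 1\<close> instead of \<open>i = 0\<close> and \<open>i = k\<close>.
\<close>

lemma root_of_unity_filter:
  fixes w :: complex
  assumes "k \<ge> 2" and "w ^ k = 1" and prim: "\<And>i. 0 < i \<Longrightarrow> i < k \<Longrightarrow> w ^ i \<noteq> 1" and "i \<le> k"
  shows "(\<Sum>j = 1..k. (w ^ (k - 1)) ^ j * (w ^ j) ^ i) = (if i = 1 then of_nat k else 0)"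
proof -
  define z where "z = w ^ (k - 1 + i)"
  have "z ^ k = (w ^ k) ^ (k - 1 + i)"
    unfolding z_def power_mult[symmetric] by (simp only: mult.commute)
  then have "z ^ k = 1" using assms(2) by simp
  have "z = 1 \<longleftrightarrow> i = 1"
  proof (cases "i = 0")
    case True
    then show ?thesis using prim[of "k - 1"] assms(1) by (simp add: z_def)
  next
    case False
    have "k - 1 + i = k + (i - 1)" using False assms(1) by simp
    then have "z = w ^ (i - 1)"
      using assms(2) by (simp only: z_def power_add mult_1_left)
    then show ?thesis using prim[of "i - 1"] assms(4) False assms(1) by (cases "i = 1") auto
  qed
  moreover have "(w ^ (k - 1)) ^ j * (w ^ j) ^ i = z ^ j" for j
    by (simp add: z_def power_add power_mult_distrib power_mult[symmetric] mult.commute)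
  ultimately show ?thesis
    using sum_powers_root_of_unity[OF \<open>z ^ k = 1\<close>] by simp
qed

lemma single_0_power:
  fixes c :: "'b::comm_semiring_1"
  shows "Poly_Mapping.single (0 :: 'a::comm_monoid_add) c ^ e = Poly_Mapping.single 0 (c ^ e)"
  by (induction e) (simp_all add: mult_single)

lemma single_sum:
  "Poly_Mapping.single t (sum f A) = (\<Sum>i\<in>A. Poly_Mapping.single t (f i))"
  by (induction A rule: infinite_finite_induct) (simp_all add: single_add)

lemma power_mult_eq_sum_of_powers:
  fixes u v :: "'a::comm_monoid_add \<Rightarrow>\<^sub>0 complex"
  assumes "k \<ge> 2"
  obtains c e :: "nat \<Rightarrow> complex" where
    "u ^ (k - 1) * v =
      (\<Sum>j = 1..k. (Poly_Mapping.single 0 (c j) * (u + Poly_Mapping.single 0 (e j) * v)) ^ k)"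
proof -
  let ?C = "Poly_Mapping.single (0 :: 'a) :: complex \<Rightarrow> _"
  have "k > 0" using assms by simp
  obtain w :: complex where w: "w ^ k = 1" "\<And>i. 0 < i \<Longrightarrow> i < k \<Longrightarrow> w ^ i \<noteq> 1"
    using exists_primitive_root_of_unity[OF \<open>k > 0\<close>] by blast
  have "w \<noteq> 0" using w(1) \<open>k > 0\<close> by (auto simp: power_0_left)
  obtain h where h: "h ^ k = w ^ (k - 1)"
    using exists_complex_root[OF \<open>k > 0\<close>, of "w ^ (k - 1)"] \<open>w \<noteq> 0\<close> by auto
  obtain b :: complex where b: "b ^ k = 1 / (of_nat k)\<^sup>2"
    using exists_complex_root[OF \<open>k > 0\<close>, of "1 / (of_nat k)\<^sup>2"] \<open>k > 0\<close> by auto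
  define c where "c j = b * h ^ j" for j
  have c: "c j ^ k = (w ^ (k - 1)) ^ j / (of_nat k)\<^sup>2" for j
  proof -
    have "c j ^ k = b ^ k * (h ^ k) ^ j"
      by (simp add: c_def power_mult_distrib power_mult[symmetric] mult.commute)
    then show ?thesis by (simp add: b h)
  qed
  define F where "F i = of_nat (k choose i) * (v ^ i * u ^ (k - i))" for i
  have "(?C (c j) * (u + ?C (w ^ j) * v)) ^ k = (\<Sum>i\<le>k. ?C (c j ^ k * (w ^ j) ^ i) * F i)" for j
  proof -
    have "(?C (c j) * (u + ?C (w ^ j) * v)) ^ k = ?C (c j ^ k) * (?C (w ^ j) * v + u) ^ k"
      by (simp add: power_mult_distrib single_0_power add.commute)
    also have "\<dots> = (\<Sum>i\<le>k. ?C (c j ^ k) * (?C ((w ^ j) ^ i) * F i))"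
      unfolding binomial_ring sum_distrib_left F_def
      by (intro sum.cong refl) (simp only: power_mult_distrib single_0_power mult_ac)
    also have "\<dots> = (\<Sum>i\<le>k. ?C (c j ^ k * (w ^ j) ^ i) * F i)"
      by (simp only: mult_single mult.assoc[symmetric] add_0_left)
    finally show ?thesis .
  qed
  then have "(\<Sum>j = 1..k. (?C (c j) * (u + ?C (w ^ j) * v)) ^ k) =
      (\<Sum>j = 1..k. \<Sum>i\<le>k. ?C (c j ^ k * (w ^ j) ^ i) * F i)" by simp
  also have "\<dots> = (\<Sum>i\<le>k. \<Sum>j = 1..k. ?C (c j ^ k * (w ^ j) ^ i) * F i)"
    by (rule sum.swap)
  also have "\<dots> = (\<Sum>i\<le>k. ?C (\<Sum>j = 1..k. c j ^ k * (w ^ j) ^ i) * F i)"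
    by (simp add: single_sum sum_distrib_right)
  also have "\<dots> = (\<Sum>i\<le>k. if i = 1 then ?C (1 / of_nat k) * F i else 0)"
  proof (rule sum.cong[OF refl])
    fix i assume "i \<in> {..k}"
    have "(\<Sum>j = 1..k. c j ^ k * (w ^ j) ^ i) =
        (\<Sum>j = 1..k. (w ^ (k - 1)) ^ j * (w ^ j) ^ i) / (of_nat k)\<^sup>2"
      by (simp add: c sum_divide_distrib)
    also have "\<dots> = (if i = 1 then 1 / of_nat k else 0)"
      using root_of_unity_filter[OF assms w, of i] \<open>i \<in> {..k}\<close> \<open>k > 0\<close>
      by (simp add: power2_eq_square)
    finally show "?C (\<Sum>j = 1..k. c j ^ k * (w ^ j) ^ i) * F i =
        (if i = 1 then ?C (1 / of_nat k) * F i else 0)" by simp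
  qed
  also have "\<dots> = ?C (1 / of_nat k) * F 1"
    using \<open>k > 0\<close> by simp
  also have "\<dots> = ?C (1 / of_nat k) * ?C (of_nat k) * (u ^ (k - 1) * v)"
    by (simp add: F_def mult_ac)
  also have "?C (1 / of_nat k) * ?C (of_nat k) = 1"
    using \<open>k > 0\<close> by (simp only: mult_single) simp
  finally show thesis using that[of c "\<lambda>j. w ^ j"] by simp
qed

section \<open>Forms and monomials\<close>

definition monomial :: "nat \<Rightarrow> (nat \<Rightarrow> nat) \<Rightarrow> cpoly" where
  "monomial n a = (\<Prod>i = 1..n. indet i ^ a i)"

text \<open>
  Collecting the product into one basis vector makes the set of exponents visible, in terms of which
  membership in the ring and homogeneity are defined.
\<close>

lemma monomial_eq_single:
  "monomial n a = Poly_Mapping.single (\<Sum>i = 1..n. Poly_Mapping.single i (a i)) 1"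
proof -
  have pow: "indet i ^ e = Poly_Mapping.single (Poly_Mapping.single i e) 1" for i e
    by (induction e) (simp_all add: indet_def mult_single single_add[symmetric])
  have "(\<Prod>i\<in>A. Poly_Mapping.single (f i) 1) = (Poly_Mapping.single (sum f A) 1 :: cpoly)"
    if "finite A" for A :: "nat set" and f
    using that by (induction A rule: finite_induct) (simp_all add: mult_single)
  then show ?thesis by (simp add: monomial_def pow)
qed

lemma monomial_power_mult:
  assumes "\<And>i. i \<in> {1..n} \<Longrightarrow> a i = r * p i + q i"
  shows "monomial n a = monomial n p ^ r * monomial n q"
  unfolding monomial_def prod_power_distrib prod.distrib[symmetric] power_mult[symmetric]
  by (intro prod.cong refl) (simp add: assms power_add mult.commute)

definition forms :: "nat \<Rightarrow> nat \<Rightarrow> cpoly set" where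
  "forms n d = {p \<in> poly_ring n. homogeneous d p}"

lemma monomial_in_forms:
  assumes "(\<Sum>i = 1..n. a i) = d"
  shows "monomial n a \<in> forms n d"
proof -
  define t where "t = (\<Sum>i = 1..n. Poly_Mapping.single i (a i))"
  have lookup: "Poly_Mapping.lookup t j = (if j \<in> {1..n} then a j else 0)" for j
  proof -
    have "Poly_Mapping.lookup t j = (\<Sum>i = 1..n. if i = j then a i else 0)"
      unfolding t_def lookup_sum by (intro sum.cong refl) (simp add: lookup_single when_def)
    then show ?thesis by simp
  qed
  have keys: "Poly_Mapping.keys t \<subseteq> {1..n}"
    by (auto simp: in_keys_iff lookup split: if_splits)
  have "expo_degree t = (\<Sum>i = 1..n. Poly_Mapping.lookup t i)"
    unfolding expo_degree_def by (rule sum.mono_neutral_left) (use keys in \<open>auto simp: in_keys_iff\<close>)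
  then have "expo_degree t = d" using assms by (simp add: lookup)
  moreover have "monomial n a = Poly_Mapping.single t 1"
    by (simp add: monomial_eq_single t_def)
  ultimately show ?thesis
    using keys by (simp add: forms_def poly_ring_def homogeneous_def)
qed

lemma forms_iff:
  "p \<in> forms n d \<longleftrightarrow>
    (\<forall>t\<in>Poly_Mapping.keys p. Poly_Mapping.keys t \<subseteq> {1..n} \<and> expo_degree t = d)"
  by (auto simp: forms_def poly_ring_def homogeneous_def)

lemma forms_add: "p \<in> forms n d \<Longrightarrow> q \<in> forms n d \<Longrightarrow> p + q \<in> forms n d"
  using keys_add[of p q] unfolding forms_iff by blast

lemma forms_scale:
  assumes "p \<in> forms n d"
  shows "Poly_Mapping.single 0 c * p \<in> forms n d"
proof -
  have "Poly_Mapping.keys (Poly_Mapping.single 0 c * p) \<subseteq> Poly_Mapping.keys p"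
    using keys_mult[of "Poly_Mapping.single 0 c" p] by (auto split: if_splits)
  then show ?thesis using assms unfolding forms_iff by blast
qed

theorem propositionB1:
  fixes k n d :: nat and a :: "nat \<Rightarrow> nat" and m :: cpoly
  assumes "k \<ge> 2" and "n \<ge> 2" and "d \<ge> 1"
    and "m = (\<Prod>i = 1..n. indet i ^ a i)"
    and "(\<Sum>i = 1..n. a i) = d * k"
    and "(k - 2) * n \<le> d"
  shows "k_rank n d k m \<le> enat k"
proof -
  have "k - 1 > 0" "k - 1 + 1 = k" "k - 1 - 1 = k - 2" using assms(1) by simp_all
  then obtain p q where pq: "\<And>i. i \<in> {1..n} \<Longrightarrow> a i = (k - 1) * p i + q i"
      "sum p {1..n} = d" "sum q {1..n} = d"
    using split_exponents[of "{1..n}" "k - 1" a d] assms(5,6) by auto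
  define u v where "u = monomial n p" and "v = monomial n q"
  have forms: "u \<in> forms n d" "v \<in> forms n d"
    using pq by (auto simp: u_def v_def intro: monomial_in_forms)
  have "m = u ^ (k - 1) * v"
    unfolding assms(4) u_def v_def monomial_def[symmetric] by (rule monomial_power_mult[OF pq(1)])
  moreover obtain c e where "u ^ (k - 1) * v =
      (\<Sum>j = 1..k. (Poly_Mapping.single 0 (c j) * (u + Poly_Mapping.single 0 (e j) * v)) ^ k)"
    using power_mult_eq_sum_of_powers[OF assms(1)] by blast
  moreover define g where
    "g j = Poly_Mapping.single 0 (c j) * (u + Poly_Mapping.single 0 (e j) * v)" for j
  ultimately have "m = (\<Sum>j = 1..k. g j ^ k)" by simp
  moreover have "g j \<in> forms n d" for j
    unfolding g_def by (intro forms_scale forms_add forms)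
  then have "\<forall>j\<in>{1..k}. g j \<in> poly_ring n \<and> homogeneous d (g j)"
    by (simp add: forms_def)
  ultimately show ?thesis
    unfolding k_rank_def by (intro Inf_lower CollectI exI[of _ k] exI[of _ g] conjI refl)
qed

end
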